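(* Let $0\le\alpha<1$ and let $s^*(r)=s^*_n(r)$ be the maximal separation distance after $r$ iterations of the down-up walk on the $n$th level of the Kingman lattice with parameters $\theta=1$ and $\alpha$. (1) For all integers $r\ge0$, $$s^*(r)=2\sum_{i=2}^n(-1)^i(i^2-1)\frac{(n!)^2}{(n-i)!\,(n+i)!}\left(1-\frac{i^2}{n^2}\right)^r.$$ (2) For $c>0$ fixed, $$\lim_{n\to\infty}s^*_n(\lfloor cn^2\rfloor)=2\sum_{i=2}^\infty(-1)^i(i^2-1)e^{-ci^2}.$$
   Context: For a partition $\lambda$, $m_k(\lambda)$ is the number of parts (rows) of size $k$ and $l(\lambda)$ the number of parts. Parameters: $\theta>0$, $0\le\alpha<1$ (here $\theta=1$). Down chain: from a partition $\lambda$ of $n$, for each $j\ge1$ with $m_j(\lambda)>0$, remove a box from a row of length $j$ (replace a part $j$ by $j-1$) with probability $\frac{j\,m_j(\lambda)}{n}$, obtaining a partition of $n-1$. Up chain: from a partition $\lambda$ of $n$, for each $k\ge1$ add a box to a row of length $k$ (replace a part $k$ by $k+1$) with probability $\frac{(k-\alpha)m_k(\lambda)}{\theta+n}$, and add a new part of size $1$ with probability $\frac{\theta+\alpha l(\lambda)}{\theta+n}$, obtaining a partition of $n+1$. The down-up walk on the $n$th level of the Kingman lattice is the Markov chain $K$ on partitions of $n$ taking one down step (to a partition of $n-1$) and then one up step. Its stationary distribution is the Pitman distribution $$\pi(\lambda)=\frac{\theta(\theta+\alpha)\cdots(\theta+(l(\lambda)-1)\alpha)}{\theta(\theta+1)\cdots(\theta+n-1)}\,\frac{n!}{\prod_k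 m_k(\lambda)!\prod_{i=1}^{l(\lambda)}\lambda_i!}\prod_{(i,j)\in\lambda,\ j\ge2}(j-1-\alpha),$$ the last product being over boxes $(i,j)$ (row $i$, column $j$) of the diagram of $\lambda$. The maximal separation distance is $s^*(r)=\max_{x,y}\left[1-\frac{K^r(x,y)}{\pi(y)}\right]$. The convention $0^0=1$ is used. *)

theory Defs
  imports "HOL-Analysis.Analysis" "HOL-Library.Multiset"
begin

text \<open>
  A partition of \<open>n\<close> is represented by the multiset of its (positive) parts, so that
  \<open>m\<^sub>k(\<nu>) = count \<nu> k\<close>, \<open>l(\<nu>) = size \<nu>\<close>, and \<open>\<nu>\<close> is a partition of \<open>sum_mset \<nu>\<close>.
\<close>

definition partitions :: "nat \<Rightarrow> nat multiset set" where
  "partitions n = {\<nu>. 0 \<notin># \<nu> \<and> sum_mset \<nu> = n}"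

definition remove_box :: "nat \<Rightarrow> nat multiset \<Rightarrow> nat multiset" where
  "remove_box j \<nu> = (if j = 1 then \<nu> - {#1#} else add_mset (j - 1) (\<nu> - {#j#}))"

definition add_box :: "nat \<Rightarrow> nat multiset \<Rightarrow> nat multiset" where
  "add_box k \<nu> = add_mset (k + 1) (\<nu> - {#k#})"

text \<open>Transition kernels are written as functions of the current and the next state.\<close>

definition down_chain :: "nat multiset \<Rightarrow> nat multiset \<Rightarrow> real" where
  "down_chain \<nu> \<mu> =
     (\<Sum>j\<in>set_mset \<nu>.
        if \<mu> = remove_box j \<nu> then real j * real (count \<nu> j) / real (sum_mset \<nu>) else 0)"

definition up_chain :: "real \<Rightarrow> real \<Rightarrow> nat multiset \<Rightarrow> nat multiset \<Rightarrow> real" where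
  "up_chain \<theta> \<alpha> \<nu> \<mu> =
     (\<Sum>k\<in>set_mset \<nu>.
        if \<mu> = add_box k \<nu>
        then (real k - \<alpha>) * real (count \<nu> k) / (\<theta> + real (sum_mset \<nu>)) else 0)
     + (if \<mu> = add_mset 1 \<nu>
        then (\<theta> + \<alpha> * real (size \<nu>)) / (\<theta> + real (sum_mset \<nu>)) else 0)"

definition down_up_walk ::
  "real \<Rightarrow> real \<Rightarrow> nat \<Rightarrow> nat multiset \<Rightarrow> nat multiset \<Rightarrow> real" where
  "down_up_walk \<theta> \<alpha> n \<nu> \<rho> =
     (\<Sum>\<mu>\<in>partitions (n - 1). down_chain \<nu> \<mu> * up_chain \<theta> \<alpha> \<mu> \<rho>)"

text \<open>
  In the product over boxes \<open>(i,j)\<close> with \<open>j \<ge> 2\<close>, a row of length \<open>p\<close> contributes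
  the columns \<open>j = 2, \<dots>, p\<close>.
\<close>

definition pitman :: "real \<Rightarrow> real \<Rightarrow> nat \<Rightarrow> nat multiset \<Rightarrow> real" where
  "pitman \<theta> \<alpha> n \<nu> =
     (\<Prod>i<size \<nu>. \<theta> + real i * \<alpha>) / (\<Prod>i<n. \<theta> + real i)
     * (fact n / ((\<Prod>k\<in>set_mset \<nu>. fact (count \<nu> k)) * (\<Prod>p\<in>#\<nu>. fact p)))
     * (\<Prod>p\<in>#\<nu>. \<Prod>j=2..p. real j - 1 - \<alpha>)"

primrec kernel_power ::
  "'a set \<Rightarrow> ('a \<Rightarrow> 'a \<Rightarrow> real) \<Rightarrow> nat \<Rightarrow> 'a \<Rightarrow> 'a \<Rightarrow> real" where
  "kernel_power S K 0 x y = (if x = y then 1 else 0)"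
| "kernel_power S K (Suc r) x y = (\<Sum>z\<in>S. K x z * kernel_power S K r z y)"

definition max_separation ::
  "'a set \<Rightarrow> ('a \<Rightarrow> 'a \<Rightarrow> real) \<Rightarrow> ('a \<Rightarrow> real) \<Rightarrow> nat \<Rightarrow> real" where
  "max_separation S K \<pi> r = Max ((\<lambda>(x, y). 1 - kernel_power S K r x y / \<pi> y) ` (S \<times> S))"

definition kingman_separation :: "real \<Rightarrow> real \<Rightarrow> nat \<Rightarrow> nat \<Rightarrow> real" where
  "kingman_separation \<theta> \<alpha> n r =
     max_separation (partitions n) (down_up_walk \<theta> \<alpha> n) (pitman \<theta> \<alpha> n) r"

text \<open>The maximum defining the separation distance is over a finite nonempty set.\<close>

lemma finite_partitions: "finite (partitions n)"
proof -
  have "partitions n \<subseteq> mset ` {xs. set xs \<subseteq> {..n} \<and> length xs \<le> n}"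
  proof
    fix p assume p: "p \<in> partitions n"
    obtain xs where xs: "mset xs = p" by (metis ex_mset)
    have len: "length xs \<le> n" and sub: "set xs \<subseteq> {..n}"
    proof -
      have s: "sum_list xs = n" and z: "0 \<notin> set xs"
        using p xs unfolding partitions_def by (auto simp: sum_mset_sum_list)
      show "set xs \<subseteq> {..n}" using s member_le_sum_list by fastforce
      have "length ys \<le> sum_list ys" if "0 \<notin> set ys" for ys :: "nat list"
        using that by (induction ys) auto
      then show "length xs \<le> n" using s z by blast
    qed
    then show "p \<in> mset ` {xs. set xs \<subseteq> {..n} \<and> length xs \<le> n}" using xs by blast
  qed
  then show ?thesis
    using finite_lists_length_le[of "{..n}" n] finite_subset by blast
qed

lemma partitions_nonempty: "partitions n \<noteq> {}"
proof -
  have "replicate_mset n 1 \<in> partitions n"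
    unfolding partitions_def by (auto simp: in_replicate_mset)
  then show ?thesis by blast
qed

end

theory Submission
  imports Defs "HOL-Real_Asymp.Real_Asymp"
begin

text \<open>
  As operators on functions of partitions, the unnormalised down and up steps satisfy
  \<open>U D = D U + (\<theta> + 2 n) I\<close> on level \<open>n\<close>. For \<open>\<theta> = 1\<close> it follows that composing the walk with
  \<open>k = n - m\<close> down steps followed by \<open>k\<close> up steps gives the mixture of ``\<open>k\<close> down, \<open>k\<close> up'' (weight
  \<open>1 - m\<^sup>2 / n\<^sup>2\<close>) and ``\<open>k + 1\<close> down, \<open>k + 1\<close> up'' (weight \<open>m\<^sup>2 / n\<^sup>2\<close>). So \<open>K\<^sup>r\<close> is the law of
  ``down to level \<open>X\<^sub>r\<close>, then up again'', where \<open>X\<close> is a pure death chain started at \<open>n\<close>. Once \<open>X\<close>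
  has reached level \<open>1\<close>, the result has exactly the Pitman distribution; before that, the one-column
  partition cannot be reached from the one-row partition. Hence \<open>s\<^sup>*(r)\<close> is the probability that
  \<open>X\<^sub>r \<ge> 2\<close>, and the explicit spectral form of this probability gives the limit by dominated convergence.
\<close>

subsection \<open>Down and up operators\<close>

text \<open>On level n this is n times the expectation of \<open>f\<close> after one down step;
  summing over rows builds the multiplicity m_j into it.\<close>

definition down_op :: "(nat multiset \<Rightarrow> real) \<Rightarrow> nat multiset \<Rightarrow> real" where
  "down_op f \<nu> = (\<Sum>j\<in>#\<nu>. real j * f (remove_box j \<nu>))"

definition up_op :: "real \<Rightarrow> real \<Rightarrow> (nat multiset \<Rightarrow> real) \<Rightarrow> nat multiset \<Rightarrow> real" where
  "up_op \<theta> \<alpha> f \<nu> =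
     (\<Sum>k\<in>#\<nu>. (real k - \<alpha>) * f (add_box k \<nu>))
     + (\<theta> + \<alpha> * real (size \<nu>)) * f (add_mset 1 \<nu>)"

text \<open>Links the chains, which sum over distinct row lengths with multiplicities, to the
  operators, which sum over rows.\<close>

lemma sum_mset_eq_sum_count:
  fixes g :: "'a \<Rightarrow> 'b::comm_semiring_1"
  shows "(\<Sum>x\<in>#M. g x) = (\<Sum>x\<in>set_mset M. of_nat (count M x) * g x)"
proof (induction M)
  case (add a M)
  have 1: "(\<Sum>x\<in>set_mset (add_mset a M). of_nat (count M x) * g x)
      = (\<Sum>x\<in>set_mset M. of_nat (count M x) * g x)"
    by (rule sum.mono_neutral_right) (auto simp: not_in_iff)
  have "(\<Sum>x\<in>set_mset (add_mset a M). of_nat (count (add_mset a M) x) * g x)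
      = (\<Sum>x\<in>set_mset (add_mset a M). of_nat (count M x) * g x + (if x = a then g x else 0))"
    by (rule sum.cong) (auto simp: algebra_simps)
  also have "\<dots> = (\<Sum>x\<in>set_mset M. of_nat (count M x) * g x) + g a"
    by (simp only: sum.distrib 1) (simp add: sum.delta)
  finally show ?case using add by (simp add: algebra_simps)
qed simp

lemma sum_mset_cong:
  "(\<And>x. x \<in># M \<Longrightarrow> g x = h x) \<Longrightarrow> (\<Sum>x\<in>#M. g x) = (\<Sum>x\<in>#M. h x)"
  by (metis image_mset_cong)

lemma sum_mset_diff_single:
  fixes g :: "'a \<Rightarrow> 'b::ab_group_add"
  shows "a \<in># M \<Longrightarrow> (\<Sum>x\<in>#M - {#a#}. g x) = (\<Sum>x\<in>#M. g x) - g a"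
  by (metis add_diff_cancel_left' insert_DiffM msed_map_invL sum_mset.insert image_mset_add_mset)

text \<open>Both sides are the full double sum minus its diagonal.\<close>

lemma sum_mset_offdiag_swap:
  fixes g :: "'a \<Rightarrow> 'a \<Rightarrow> real"
  shows "(\<Sum>j\<in>#M. \<Sum>k\<in>#M - {#j#}. g j k) = (\<Sum>k\<in>#M. \<Sum>j\<in>#M - {#k#}. g j k)"
proof -
  have sub: "(\<Sum>j\<in>#M. a j - b j) = (\<Sum>j\<in>#M. a j) - (\<Sum>j\<in>#M. b j)" for a b :: "'a \<Rightarrow> real"
    by (induction M) auto
  have "(\<Sum>j\<in>#M. \<Sum>k\<in>#M - {#j#}. g j k) = (\<Sum>j\<in>#M. (\<Sum>k\<in>#M. g j k) - g j j)"
    by (rule sum_mset_cong) (rule sum_mset_diff_single)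
  also have "\<dots> = (\<Sum>k\<in>#M. (\<Sum>j\<in>#M. g j k) - g k k)"
    using sum_mset.swap[of g M M] by (simp add: sub)
  also have "\<dots> = (\<Sum>k\<in>#M. \<Sum>j\<in>#M - {#k#}. g j k)"
    by (rule sum_mset_cong) (rule sum_mset_diff_single[symmetric])
  finally show ?thesis .
qed

section \<open>Moves of a single box\<close>

lemma remove_box_add_same:
  "remove_box j (add_mset j \<nu>) = (if j = 1 then \<nu> else add_mset (j - 1) \<nu>)"
  by (simp add: remove_box_def)

lemma remove_box_add_mset:
  "j \<in># \<nu> \<Longrightarrow> remove_box j (add_mset a \<nu>) = add_mset a (remove_box j \<nu>)"
  unfolding remove_box_def
  by (cases "j = a") (auto simp: add_mset_commute dest: multi_member_split)

lemma add_box_add_same: "add_box k (add_mset k \<nu>) = add_mset (Suc k) \<nu>"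
  by (simp add: add_box_def)

lemma remove_box_add_box:
  assumes "k \<in># \<nu>" "k \<noteq> 0"
  shows "remove_box (Suc k) (add_box k \<nu>) = \<nu>"
  using assms by (simp add: remove_box_def add_box_def)

lemma add_box_remove_box:
  assumes "Suc k \<in># \<nu>" "k \<noteq> 0"
  shows "add_box k (remove_box (Suc k) \<nu>) = \<nu>"
  using assms by (simp add: remove_box_def add_box_def)

lemma remove_box_partitions:
  assumes "\<nu> \<in> partitions n" "j \<in># \<nu>"
  shows "remove_box j \<nu> \<in> partitions (n - 1)"
  using assms by (auto simp: remove_box_def partitions_def dest!: multi_member_split)

lemma add_box_partitions:
  assumes "\<nu> \<in> partitions n" "k \<in># \<nu>"
  shows "add_box k \<nu> \<in> partitions (Suc n)"
  using assms by (auto simp: add_box_def partitions_def dest!: multi_member_split)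

lemma add_one_partitions: "\<nu> \<in> partitions n \<Longrightarrow> add_mset 1 \<nu> \<in> partitions (Suc n)"
  by (auto simp: partitions_def)

lemma partitions_part_pos: "\<nu> \<in> partitions n \<Longrightarrow> j \<in># \<nu> \<Longrightarrow> 1 \<le> j"
  by (auto simp: partitions_def intro: Suc_leI gr0I)

lemma partitions_part_le: "\<nu> \<in> partitions n \<Longrightarrow> j \<in># \<nu> \<Longrightarrow> j \<le> n"
  by (auto simp: partitions_def dest!: multi_member_split)

lemma partitions_part_imp_pos: "\<nu> \<in> partitions n \<Longrightarrow> j \<in># \<nu> \<Longrightarrow> 1 \<le> n"
  using partitions_part_pos partitions_part_le le_trans by blast

lemma partitions_0: "partitions 0 = {{#}}"
  by (auto simp: partitions_def) (metis multiset_nonemptyE)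

lemma sum_parts: "\<nu> \<in> partitions n \<Longrightarrow> (\<Sum>j\<in>#\<nu>. real j) = real n"
  by (auto simp: partitions_def)

text \<open>On level 0 the down operator is an empty sum, so agreement is demanded only for n \<ge>
  1, where n - 1 is not truncated.\<close>

lemma down_op_cong:
  assumes "\<nu> \<in> partitions n" "\<And>\<mu>. n \<ge> 1 \<Longrightarrow> \<mu> \<in> partitions (n - 1) \<Longrightarrow> f \<mu> = g \<mu>"
  shows "down_op f \<nu> = down_op g \<nu>"
  unfolding down_op_def
  using assms remove_box_partitions partitions_part_imp_pos by (intro sum_mset_cong) auto

lemma down_op_lincomb:
  "down_op (\<lambda>\<mu>. f \<mu> + c * g \<mu>) \<nu> = down_op f \<nu> + c * down_op g \<nu>"
proof -
  have "(\<Sum>j\<in>#M. real j * (f (h j) + c * g (h j)))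
      = (\<Sum>j\<in>#M. real j * f (h j)) + c * (\<Sum>j\<in>#M. real j * g (h j))" for M h
    by (induction M) (auto simp: algebra_simps)
  then show ?thesis unfolding down_op_def .
qed

lemma up_op_cmult: "up_op \<theta> \<alpha> (\<lambda>\<mu>. c * g \<mu>) \<nu> = c * up_op \<theta> \<alpha> g \<nu>"
proof -
  have "(\<Sum>j\<in>#M. (real j - \<alpha>) * (c * g (h j))) = c * (\<Sum>j\<in>#M. (real j - \<alpha>) * g (h j))" for M h
    by (induction M) (auto simp: algebra_simps)
  then show ?thesis unfolding up_op_def by (simp add: algebra_simps)
qed

text \<open>Removing the new box returns \<nu>; a removal from any other row commutes with the
  addition.\<close>

lemma down_op_add_box:
  assumes "k \<in># \<nu>" "k \<noteq> 0"
  shows "down_op f (add_box k \<nu>) =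
    (\<Sum>j\<in>#\<nu> - {#k#}. real j * f (add_box k (remove_box j \<nu>))) + (real k + 1) * f \<nu>"
proof -
  obtain \<xi> where \<xi>: "\<nu> = add_mset k \<xi>" using assms(1) by (blast dest: multi_member_split)
  have "down_op f (add_box k \<nu>)
      = (\<Sum>j\<in>#\<xi>. real j * f (remove_box j (add_mset (Suc k) \<xi>))) + (real k + 1) * f \<nu>"
    using assms(2) by (simp add: down_op_def \<xi> add_box_add_same remove_box_add_same)
  also have "(\<Sum>j\<in>#\<xi>. real j * f (remove_box j (add_mset (Suc k) \<xi>)))
      = (\<Sum>j\<in>#\<xi>. real j * f (add_box k (remove_box j \<nu>)))"
    by (rule sum_mset_cong) (simp add: \<xi> remove_box_add_mset add_box_add_same)
  finally show ?thesis by (simp add: \<xi>)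
qed

lemma down_op_add_one:
  "down_op f (add_mset 1 \<nu>) = (\<Sum>j\<in>#\<nu>. real j * f (add_mset 1 (remove_box j \<nu>))) + f \<nu>"
proof -
  have "(\<Sum>j\<in>#\<nu>. real j * f (remove_box j (add_mset 1 \<nu>)))
      = (\<Sum>j\<in>#\<nu>. real j * f (add_mset 1 (remove_box j \<nu>)))"
    by (rule sum_mset_cong) (simp add: remove_box_add_mset)
  then show ?thesis by (simp add: down_op_def remove_box_add_same[of 1, simplified])
qed

text \<open>One formula covers two cases. For j > 1 the shortened row regains its box with weight j
  - 1 - \<alpha>. For j = 1 the row vanishes, the weight of a new part drops by \<alpha>, and the
  new part restores \<nu>.\<close>

lemma up_op_remove_box:
  assumes "j \<in># \<nu>" "j \<noteq> 0"
  shows "up_op \<theta> \<alpha> f (remove_box j \<nu>) =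
    (\<Sum>k\<in>#\<nu> - {#j#}. (real k - \<alpha>) * f (add_box k (remove_box j \<nu>)))
    + (real j - 1 - \<alpha>) * f \<nu>
    + (\<theta> + \<alpha> * real (size \<nu>)) * f (add_mset 1 (remove_box j \<nu>))"
proof -
  obtain \<xi> where \<xi>: "\<nu> = add_mset j \<xi>" using assms(1) by (blast dest: multi_member_split)
  show ?thesis
  proof (cases "j = 1")
    case True
    then show ?thesis
      by (simp add: up_op_def \<xi> remove_box_add_same[of 1, simplified] algebra_simps)
  next
    case False
    then show ?thesis using assms(2)
      by (simp add: up_op_def \<xi> remove_box_add_same add_box_add_same algebra_simps of_nat_diff)
  qed
qed

section \<open>Commutation relations\<close>

text \<open>Moves in two different rows (\<open>P\<close>) and moves combined with a new row
  (\<open>Q\<close>) contribute equally in both orders; only moves that undo each other leave a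
  difference.\<close>

lemma up_down_commutation:
  assumes \<nu>: "\<nu> \<in> partitions n"
  shows "up_op \<theta> \<alpha> (down_op f) \<nu> = down_op (up_op \<theta> \<alpha> f) \<nu> + (\<theta> + 2 * real n) * f \<nu>"
proof -
  define l where "l = \<theta> + \<alpha> * real (size \<nu>)"
  define P where "P = (\<Sum>j\<in>#\<nu>. \<Sum>k\<in>#\<nu> - {#j#}.
    real j * (real k - \<alpha>) * f (add_box k (remove_box j \<nu>)))"
  define Q where "Q = (\<Sum>j\<in>#\<nu>. real j * f (add_mset 1 (remove_box j \<nu>)))"
  have pos: "j \<noteq> 0" if "j \<in># \<nu>" for j using partitions_part_pos[OF \<nu> that] by simp
  have add3: "(\<Sum>j\<in>#M. a j + b j + c j) = (\<Sum>j\<in>#M. a j) + (\<Sum>j\<in>#M. b j) + (\<Sum>j\<in>#M. c j)"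
    for a b c :: "nat \<Rightarrow> real" and M by (induction M) auto
  have "(\<Sum>k\<in>#\<nu>. (real k - \<alpha>) * down_op f (add_box k \<nu>))
      = (\<Sum>k\<in>#\<nu>. (\<Sum>j\<in>#\<nu> - {#k#}. real j * (real k - \<alpha>) * f (add_box k (remove_box j \<nu>)))
           + (real k - \<alpha>) * (real k + 1) * f \<nu> + 0)"
    by (rule sum_mset_cong)
      (simp add: down_op_add_box pos sum_mset_distrib_left distrib_left ac_simps)
  also have "\<dots> = P + (\<Sum>k\<in>#\<nu>. (real k - \<alpha>) * (real k + 1) * f \<nu>)"
    unfolding add3 P_def by (subst sum_mset_offdiag_swap) simp
  finally have ud: "up_op \<theta> \<alpha> (down_op f) \<nu>
      = P + (\<Sum>k\<in>#\<nu>. (real k - \<alpha>) * (real k + 1) * f \<nu>) + l * Q + l * f \<nu>"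
    by (simp only: up_op_def down_op_add_one Q_def l_def) (simp add: algebra_simps)
  have "down_op (up_op \<theta> \<alpha> f) \<nu>
      = (\<Sum>j\<in>#\<nu>. (\<Sum>k\<in>#\<nu> - {#j#}. real j * (real k - \<alpha>) * f (add_box k (remove_box j \<nu>)))
           + real j * (real j - 1 - \<alpha>) * f \<nu> + l * (real j * f (add_mset 1 (remove_box j \<nu>))))"
    unfolding down_op_def
    by (rule sum_mset_cong)
      (simp add: up_op_remove_box pos sum_mset_distrib_left distrib_left ac_simps l_def)
  also have "\<dots> = P + (\<Sum>j\<in>#\<nu>. real j * (real j - 1 - \<alpha>) * f \<nu>) + l * Q"
    unfolding add3 P_def Q_def by (simp add: sum_mset_distrib_left)
  finally have du: "down_op (up_op \<theta> \<alpha> f) \<nu>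
      = P + (\<Sum>j\<in>#\<nu>. real j * (real j - 1 - \<alpha>) * f \<nu>) + l * Q" .
  \<comment> \<open>Row by row, (k - \<alpha>)(k + 1) - k(k - 1 - \<alpha>) = 2k - \<alpha>. In the
    sum the \<alpha> terms cancel against \<open>l\<close>, leaving \<theta> + 2n.\<close>
  have "(\<Sum>k\<in>#M. (real k - \<alpha>) * (real k + 1) * f \<nu>)
      = (\<Sum>j\<in>#M. real j * (real j - 1 - \<alpha>) * f \<nu>)
        + (2 * (\<Sum>j\<in>#M. real j) - \<alpha> * real (size M)) * f \<nu>" for M
    by (induction M) (auto simp: algebra_simps)
  then show ?thesis using ud du sum_parts[OF \<nu>] by (simp add: l_def algebra_simps)
qed

text \<open>Moving the up step past k + 1 down steps meets the levels n, ..., n - k; the constants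
  \<theta> + 2(n - i) add up to (k + 1)(\<theta> + 2n - k).\<close>

lemma up_down_power_commutation:
  assumes "\<nu> \<in> partitions n"
  shows "up_op \<theta> \<alpha> ((down_op ^^ Suc k) f) \<nu> = (down_op ^^ Suc k) (up_op \<theta> \<alpha> f) \<nu>
    + real (Suc k) * (\<theta> + 2 * real n - real k) * (down_op ^^ k) f \<nu>"
  using assms
proof (induction k arbitrary: n \<nu>)
  case 0
  then show ?case by (simp add: up_down_commutation)
next
  case (Suc k)
  let ?g = "(down_op ^^ Suc k) f"
  have "up_op \<theta> \<alpha> ((down_op ^^ Suc (Suc k)) f) \<nu>
      = down_op (up_op \<theta> \<alpha> ?g) \<nu> + (\<theta> + 2 * real n) * ?g \<nu>"
    using up_down_commutation[OF Suc.prems] by simp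
  also have "down_op (up_op \<theta> \<alpha> ?g) \<nu>
      = down_op (\<lambda>\<mu>. (down_op ^^ Suc k) (up_op \<theta> \<alpha> f) \<mu>
          + real (Suc k) * (\<theta> + 2 * (real n - 1) - real k) * (down_op ^^ k) f \<mu>) \<nu>"
    using Suc.IH by (intro down_op_cong[OF Suc.prems]) (simp add: of_nat_diff)
  also have "\<dots> = (down_op ^^ Suc (Suc k)) (up_op \<theta> \<alpha> f) \<nu>
      + real (Suc k) * (\<theta> + 2 * (real n - 1) - real k) * ?g \<nu>"
    by (subst down_op_lincomb) simp
  finally show ?case by (simp add: algebra_simps)
qed

text \<open>For \<theta> = 1 and k = n - m the coefficient k(2n - k) is n^2 - m^2; divided by n^2 it
  is the holding probability of the death chain at m.\<close>

lemma down_up_power: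
  assumes \<nu>: "\<nu> \<in> partitions n"
  shows "down_op (up_op \<theta> \<alpha> ((down_op ^^ k) ((up_op \<theta> \<alpha> ^^ k) f))) \<nu>
    = (down_op ^^ Suc k) ((up_op \<theta> \<alpha> ^^ Suc k) f) \<nu>
      + real k * (\<theta> + 2 * real n - real k - 1) * (down_op ^^ k) ((up_op \<theta> \<alpha> ^^ k) f) \<nu>"
proof (cases k)
  case 0
  then show ?thesis by simp
next
  case (Suc i)
  let ?g = "(up_op \<theta> \<alpha> ^^ k) f"
  have "down_op (up_op \<theta> \<alpha> ((down_op ^^ k) ?g)) \<nu>
      = down_op (\<lambda>\<mu>. (down_op ^^ k) (up_op \<theta> \<alpha> ?g) \<mu>
          + real k * (\<theta> + 2 * (real n - 1) - real i) * (down_op ^^ i) ?g \<mu>) \<nu>"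
    using up_down_power_commutation[where k = i]
    by (intro down_op_cong[OF \<nu>]) (simp add: of_nat_diff Suc del: funpow.simps)
  also have "\<dots> = (down_op ^^ Suc k) ((up_op \<theta> \<alpha> ^^ Suc k) f) \<nu>
      + real k * (\<theta> + 2 * (real n - 1) - real i) * (down_op ^^ k) ?g \<nu>"
    by (subst down_op_lincomb) (simp add: Suc)
  finally show ?thesis by (simp add: Suc algebra_simps)
qed

subsection \<open>Transition kernels and the Pitman distribution\<close>

lemma sum_down_chain:
  assumes \<nu>: "\<nu> \<in> partitions n"
  shows "(\<Sum>\<mu>\<in>partitions (n - 1). down_chain \<nu> \<mu> * g \<mu>) = down_op g \<nu> / real n"
proof -
  have n: "sum_mset \<nu> = n" using \<nu> by (simp add: partitions_def)
  have "(\<Sum>\<mu>\<in>partitions (n - 1). down_chain \<nu> \<mu> * g \<mu>)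
     = (\<Sum>j\<in>set_mset \<nu>. \<Sum>\<mu>\<in>partitions (n - 1).
          if \<mu> = remove_box j \<nu> then real j * real (count \<nu> j) / real n * g \<mu> else 0)"
    unfolding down_chain_def n sum_distrib_right
    by (subst sum.swap) (intro sum.cong refl, auto)
  also have "\<dots> = (\<Sum>j\<in>set_mset \<nu>. real (count \<nu> j) * (real j * g (remove_box j \<nu>)) / real n)"
    using remove_box_partitions[OF \<nu>]
    by (intro sum.cong refl) (simp add: sum.delta finite_partitions)
  finally show ?thesis
    by (simp add: down_op_def sum_mset_eq_sum_count sum_divide_distrib)
qed

lemma sum_up_chain:
  assumes \<nu>: "\<nu> \<in> partitions n"
  shows "(\<Sum>\<rho>\<in>partitions (Suc n). up_chain \<theta> \<alpha> \<nu> \<rho> * g \<rho>) = up_op \<theta> \<alpha> g \<nu> / (\<theta> + real n)"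
proof -
  have n: "sum_mset \<nu> = n" using \<nu> by (simp add: partitions_def)
  have "(\<Sum>\<rho>\<in>partitions (Suc n). up_chain \<theta> \<alpha> \<nu> \<rho> * g \<rho>)
     = (\<Sum>k\<in>set_mset \<nu>. \<Sum>\<rho>\<in>partitions (Suc n).
          if \<rho> = add_box k \<nu> then (real k - \<alpha>) * real (count \<nu> k) / (\<theta> + real n) * g \<rho> else 0)
     + (\<Sum>\<rho>\<in>partitions (Suc n).
          if \<rho> = add_mset 1 \<nu> then (\<theta> + \<alpha> * real (size \<nu>)) / (\<theta> + real n) * g \<rho> else 0)"
    unfolding up_chain_def n sum_distrib_right distrib_right sum.distrib
    by (subst sum.swap) (intro arg_cong2[of _ _ _ _ "(+)"] sum.cong refl, auto)
  also have "\<dots> = (\<Sum>k\<in>set_mset \<nu>.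
        real (count \<nu> k) * ((real k - \<alpha>) * g (add_box k \<nu>)) / (\<theta> + real n))
     + (\<theta> + \<alpha> * real (size \<nu>)) * g (add_mset 1 \<nu>) / (\<theta> + real n)"
    using add_box_partitions[OF \<nu>] add_one_partitions[OF \<nu>]
    by (intro arg_cong2[of _ _ _ _ "(+)"] sum.cong refl) (simp_all add: sum.delta finite_partitions)
  finally show ?thesis
    by (simp add: up_op_def sum_mset_eq_sum_count sum_divide_distrib add_divide_distrib)
qed

lemma sum_down_up_walk:
  assumes \<nu>: "\<nu> \<in> partitions n" and n: "n \<ge> 1"
  shows "(\<Sum>\<rho>\<in>partitions n. down_up_walk \<theta> \<alpha> n \<nu> \<rho> * g \<rho>)
    = down_op (up_op \<theta> \<alpha> g) \<nu> / (real n * (\<theta> + real n - 1))"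
proof -
  have "(\<Sum>\<rho>\<in>partitions n. down_up_walk \<theta> \<alpha> n \<nu> \<rho> * g \<rho>)
      = (\<Sum>\<mu>\<in>partitions (n - 1). down_chain \<nu> \<mu> *
           (\<Sum>\<rho>\<in>partitions (Suc (n - 1)). up_chain \<theta> \<alpha> \<mu> \<rho> * g \<rho>))"
    using n unfolding down_up_walk_def sum_distrib_right sum_distrib_left
    by (subst sum.swap) (simp add: mult.assoc)
  \<comment> \<open>The summand 0 gives the function the shape of \<open>down_op_lincomb\<close>,
    which then extracts the constant.\<close>
  also have "\<dots> = (\<Sum>\<mu>\<in>partitions (n - 1). down_chain \<nu> \<mu> *
       (0 + 1 / (\<theta> + real n - 1) * up_op \<theta> \<alpha> g \<mu>))"
    using n by (intro sum.cong refl, subst sum_up_chain) (simp_all add: of_nat_diff add_diff_eq)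
  also have "\<dots> = down_op (\<lambda>\<mu>. 0 + 1 / (\<theta> + real n - 1) * up_op \<theta> \<alpha> g \<mu>) \<nu> / real n"
    by (rule sum_down_chain[OF \<nu>])
  also have "\<dots> = down_op (up_op \<theta> \<alpha> g) \<nu> / (real n * (\<theta> + real n - 1))"
    by (subst down_op_lincomb) (simp add: down_op_def)
  finally show ?thesis .
qed

section \<open>Reversibility with respect to the Pitman distribution\<close>

text \<open>Multiplying \<open>pitman\<close> by this cancels all factors that depend on n alone;
  what remains changes by a local factor when a part is added.\<close>

definition pitman_norm :: "real \<Rightarrow> nat \<Rightarrow> real" where
  "pitman_norm \<theta> n = (\<Prod>i<n. \<theta> + real i) / fact n"

lemma pitman_norm_pos: "\<theta> > 0 \<Longrightarrow> pitman_norm \<theta> n > 0"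
  unfolding pitman_norm_def by (intro divide_pos_pos prod_pos) auto

lemma pitman_norm_Suc: "pitman_norm \<theta> (Suc n) = pitman_norm \<theta> n * ((\<theta> + real n) / real (Suc n))"
  by (simp add: pitman_norm_def)

text \<open>The new part brings the next factor of the product in \<theta> and \<alpha>, its own row
  weight, and one factor of a multiplicity factorial.\<close>

lemma pitman_add_mset:
  assumes th: "\<theta> > 0"
  shows "pitman \<theta> \<alpha> (n + p) (add_mset p \<nu>) * pitman_norm \<theta> (n + p) =
    pitman \<theta> \<alpha> n \<nu> * pitman_norm \<theta> n * ((\<theta> + real (size \<nu>) * \<alpha>)
      * ((\<Prod>j=2..p. real j - 1 - \<alpha>) / (real (count (add_mset p \<nu>) p) * fact p)))"
proof -
  let ?M = "\<lambda>\<nu>::nat multiset. \<Prod>k\<in>set_mset \<nu>. fact (count \<nu> k) :: real"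
  have M: "?M (add_mset p \<nu>) = real (count (add_mset p \<nu>) p) * ?M \<nu>"
  proof -
    have "?M \<nu> = (\<Prod>k\<in>insert p (set_mset \<nu>). fact (count \<nu> k))"
      by (rule prod.mono_neutral_left) (auto simp: not_in_iff)
    moreover have "?M (add_mset p \<nu>)
      = (\<Prod>k\<in>insert p (set_mset \<nu>). (if k = p then real (count (add_mset p \<nu>) p) else 1) * fact (count \<nu> k))"
      by (auto intro!: prod.cong)
    ultimately show ?thesis by (simp only: prod.distrib) (simp add: prod.delta)
  qed
  have nz: "(\<Prod>i<m. \<theta> + real i) \<noteq> 0" for m
    using th by (auto simp: add_nonneg_eq_0_iff)
  have eq: "pitman \<theta> \<alpha> m \<mu> * pitman_norm \<theta> m = (\<Prod>i<size \<mu>. \<theta> + real i * \<alpha>)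
      / (?M \<mu> * (\<Prod>p\<in>#\<mu>. fact p)) * (\<Prod>p\<in>#\<mu>. \<Prod>j=2..p. real j - 1 - \<alpha>)" for m \<mu>
    unfolding pitman_def pitman_norm_def using nz[of m] by simp
  show ?thesis unfolding eq M by (simp add: mult_ac)
qed

lemma pitman_pos:
  assumes "\<nu> \<in> partitions n" "\<theta> > 0" "0 \<le> \<alpha>" "\<alpha> < 1"
  shows "pitman \<theta> \<alpha> n \<nu> > 0"
proof -
  have "(\<Prod>p\<in>#M. \<Prod>j=2..p. real j - 1 - \<alpha>) > 0" for M
    by (induction M) (use assms in \<open>auto intro!: mult_pos_pos prod_pos\<close>)
  moreover have "(\<Prod>p\<in>#M. fact p :: real) > 0" for M
    by (induction M) auto
  ultimately show ?thesis
    unfolding pitman_def using assms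
    by (intro mult_pos_pos divide_pos_pos prod_pos) (auto intro: add_pos_nonneg)
qed

text \<open>Before and after the move the partition is the same remainder \<xi> plus one row, so
  \<open>pitman_add_mset\<close> expresses both weights through \<xi>.\<close>

lemma pitman_add_box_balance:
  assumes x: "x \<in> partitions n" and k: "k \<in># x" and th: "\<theta> > 0"
  shows "pitman \<theta> \<alpha> n x * ((real k - \<alpha>) * real (count x k) / (\<theta> + real n))
    = pitman \<theta> \<alpha> (Suc n) (add_box k x) * (real (Suc k) * real (count (add_box k x) (Suc k)) / real (Suc n))"
proof -
  obtain \<xi> where \<xi>: "x = add_mset k \<xi>" using k by (blast dest: multi_member_split)
  define m where "m = sum_mset \<xi>"
  define c where "c = real (count x k)"
  define d where "d = real (count (add_box k x) (Suc k))"
  define N where "N = pitman_norm \<theta> n"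
  define \<phi> where "\<phi> = (\<Prod>j=2..k. real j - 1 - \<alpha>)"
  define P where "P = pitman \<theta> \<alpha> m \<xi> * pitman_norm \<theta> m * (\<theta> + real (size \<xi>) * \<alpha>)"
  have n: "n = m + k" using x by (auto simp: \<xi> m_def partitions_def)
  have y: "add_box k x = add_mset (Suc k) \<xi>" by (simp add: \<xi> add_box_add_same)
  have pos: "c > 0" "d > 0" "N > 0" "\<theta> + real n > 0"
    using k th by (auto simp: c_def d_def y N_def pitman_norm_pos)
  have pr: "(\<Prod>j=2..Suc k. real j - 1 - \<alpha>) = \<phi> * (real k - \<alpha>)"
    using partitions_part_pos[OF x k] by (simp add: atLeastAtMostSuc_conv \<phi>_def)
  have "pitman \<theta> \<alpha> n x * N = P * (\<phi> / (c * fact k))"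
    unfolding N_def P_def \<phi>_def c_def n \<xi> by (simp only: pitman_add_mset[OF th] mult.assoc)
  then have 1: "pitman \<theta> \<alpha> n x * c = P * \<phi> / (fact k * N)"
    using pos by (simp add: field_simps)
  have "pitman \<theta> \<alpha> (Suc n) (add_box k x) * (N * ((\<theta> + real n) / real (Suc n)))
      = P * (\<phi> * (real k - \<alpha>) / (d * (real (Suc k) * fact k)))"
    using pitman_add_mset[OF th, of \<alpha> m "Suc k" \<xi>] pitman_norm_Suc[of \<theta> n]
    unfolding N_def P_def d_def y pr by (simp only: n add_Suc_right fact_Suc of_nat_mult mult.assoc times_divide_eq_right)
  then have 2: "pitman \<theta> \<alpha> (Suc n) (add_box k x) * (real (Suc k) * d / real (Suc n))
      = P * \<phi> / (fact k * N) * ((real k - \<alpha>) / (\<theta> + real n))"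
    using pos by (simp add: divide_simps del: of_nat_Suc) (simp add: mult_ac)
  show ?thesis
    unfolding c_def[symmetric] d_def[symmetric] 2 1[symmetric] by simp
qed

lemma pitman_add_one_balance:
  assumes th: "\<theta> > 0"
  shows "pitman \<theta> \<alpha> n x * ((\<theta> + \<alpha> * real (size x)) / (\<theta> + real n))
    = pitman \<theta> \<alpha> (Suc n) (add_mset 1 x) * (real (count (add_mset 1 x) 1) / real (Suc n))"
proof -
  define c where "c = real (count (add_mset 1 x) 1)"
  define N where "N = pitman_norm \<theta> n"
  have pos: "c > 0" "N > 0" "\<theta> + real n > 0"
    using th by (auto simp: c_def N_def pitman_norm_pos)
  have "pitman \<theta> \<alpha> (Suc n) (add_mset 1 x) * (N * ((\<theta> + real n) / real (Suc n)))
      = pitman \<theta> \<alpha> n x * N * (\<theta> + real (size x) * \<alpha>) / c"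
    using pitman_add_mset[OF th, of \<alpha> n 1 x] pitman_norm_Suc[of \<theta> n]
    unfolding N_def c_def by simp
  then show ?thesis
    unfolding c_def[symmetric] using pos by (simp add: divide_simps del: of_nat_Suc) (simp add: mult_ac)
qed

lemma partitions_parts_subset:
  assumes "\<nu> \<in> partitions n" "n \<le> m"
  shows "set_mset \<nu> \<subseteq> {1..m}"
  using partitions_part_pos[OF assms(1)] partitions_part_le[OF assms(1)] assms(2)
  by (meson atLeastAtMost_iff le_trans subsetI)

text \<open>Each up move is paired with its inverse: k to k + 1 with k + 1 to k, and a new part with
  the removal of a part 1.\<close>

lemma pitman_detailed_balance:
  assumes x: "x \<in> partitions n" and y: "y \<in> partitions (Suc n)" and th: "\<theta> > 0"
  shows "pitman \<theta> \<alpha> n x * up_chain \<theta> \<alpha> x y = pitman \<theta> \<alpha> (Suc n) y * down_chain y x"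
proof -
  let ?u = "\<lambda>k. if y = add_box k x then (real k - \<alpha>) * real (count x k) / (\<theta> + real n) else 0"
  let ?u1 = "if y = add_mset 1 x then (\<theta> + \<alpha> * real (size x)) / (\<theta> + real n) else 0"
  let ?d = "\<lambda>j. if x = remove_box j y then real j * real (count y j) / real (Suc n) else 0"
  have sx: "sum_mset x = n" and sy: "sum_mset y = Suc n"
    using x y by (auto simp: partitions_def)
  have up: "up_chain \<theta> \<alpha> x y = (\<Sum>k\<in>{1..Suc n}. ?u k) + ?u1"
    unfolding up_chain_def sx
    by (intro arg_cong2[of _ _ _ _ "(+)"] refl sum.mono_neutral_left)
      (use partitions_parts_subset[OF x, of "Suc n"] in \<open>auto simp: not_in_iff\<close>)
  \<comment> \<open>The range exceeds the largest possible part by one, so that after the shift it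
    matches the range in \<open>up\<close>; absent lengths have count 0.\<close>
  have "down_chain y x = (\<Sum>j\<in>{1..Suc (Suc n)}. ?d j)"
    unfolding down_chain_def sy
    by (intro sum.mono_neutral_left)
      (use partitions_parts_subset[OF y, of "Suc (Suc n)"] in \<open>auto simp: not_in_iff\<close>)
  also have "\<dots> = (\<Sum>k\<in>{1..Suc n}. ?d (Suc k)) + ?d 1"
    by (subst sum.atLeast_Suc_atMost) (simp_all add: sum.shift_bounds_cl_Suc_ivl del: sum.cl_ivl_Suc)
  finally have down: "down_chain y x = (\<Sum>k\<in>{1..Suc n}. ?d (Suc k)) + ?d 1" .
  have "pitman \<theta> \<alpha> n x * ?u k = pitman \<theta> \<alpha> (Suc n) y * ?d (Suc k)" if "k \<in> {1..Suc n}" for k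
  proof (cases "k \<in># x \<and> y = add_box k x")
    case True
    then show ?thesis
      using pitman_add_box_balance[OF x _ th, of k \<alpha>] remove_box_add_box[of k x] that by simp
  next
    case False
    have "?d (Suc k) = 0"
    proof (rule ccontr)
      assume "?d (Suc k) \<noteq> 0"
      then have "x = remove_box (Suc k) y" "Suc k \<in># y"
        by (auto split: if_splits simp: count_eq_zero_iff)
      then have "k \<in># x" "y = add_box k x"
        using that add_box_remove_box[of k y] by (auto simp: remove_box_def)
      with False show False by simp
    qed
    moreover have "?u k = 0" using False by (auto simp: not_in_iff)
    ultimately show ?thesis by simp
  qed
  moreover have "pitman \<theta> \<alpha> n x * ?u1 = pitman \<theta> \<alpha> (Suc n) y * ?d 1"
  proof (cases "y = add_mset 1 x")
    case True
    then show ?thesis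
      using pitman_add_one_balance[OF th, of \<alpha> n x] remove_box_add_same[of 1 x] by simp
  next
    case False
    then have "?d 1 = 0"
      by (auto simp: remove_box_def count_eq_zero_iff dest: insert_DiffM)
    with False show ?thesis by simp
  qed
  ultimately show ?thesis
    unfolding up down by (simp add: distrib_left sum_distrib_left del: sum.cl_ivl_Suc)
qed

text \<open>One up step carries the Pitman law of level n to that of level n + 1: reversibility
  turns it into a down step, whose probabilities sum to 1.\<close>

lemma pitman_up_op:
  assumes th: "\<theta> > 0"
  shows "(\<Sum>x\<in>partitions n. pitman \<theta> \<alpha> n x * up_op \<theta> \<alpha> g x)
    = (\<theta> + real n) * (\<Sum>y\<in>partitions (Suc n). pitman \<theta> \<alpha> (Suc n) y * g y)"
proof -
  have nz: "\<theta> + real n \<noteq> 0" using th by linarith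
  have down1: "(\<Sum>x\<in>partitions n. down_chain y x) = 1" if "y \<in> partitions (Suc n)" for y
    using sum_down_chain[OF that, of "\<lambda>_. 1"] sum_parts[OF that] by (simp add: down_op_def)
  have "(\<Sum>x\<in>partitions n. pitman \<theta> \<alpha> n x * up_op \<theta> \<alpha> g x)
      = (\<Sum>x\<in>partitions n. (\<theta> + real n) *
          (\<Sum>y\<in>partitions (Suc n). pitman \<theta> \<alpha> n x * up_chain \<theta> \<alpha> x y * g y))"
    using nz by (intro sum.cong refl) (simp add: sum_up_chain sum_distrib_left[symmetric] mult.assoc)
  also have "\<dots> = (\<theta> + real n) * (\<Sum>x\<in>partitions n. \<Sum>y\<in>partitions (Suc n).
      pitman \<theta> \<alpha> (Suc n) y * g y * down_chain y x)"
    unfolding sum_distrib_left[symmetric]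
    by (intro arg_cong[of _ _ "(*) (\<theta> + real n)"] sum.cong refl)
      (simp add: pitman_detailed_balance th)
  also have "\<dots> = (\<theta> + real n) * (\<Sum>y\<in>partitions (Suc n). pitman \<theta> \<alpha> (Suc n) y * g y)"
    by (subst sum.swap) (simp add: sum_distrib_left[symmetric] down1)
  finally show ?thesis .
qed

section \<open>Level one, where the start is forgotten\<close>

lemma partitions_1: "partitions 1 = {{#1#}}"
proof -
  have "x = {#1#}" if x: "x \<in> partitions 1" for x
  proof (cases x)
    case empty
    with x show ?thesis by (simp add: partitions_def)
  next
    case (add a \<xi>)
    with x have "a \<noteq> 0" "a + sum_mset \<xi> = 1" "0 \<notin># \<xi>" by (auto simp: partitions_def)
    then have "a = 1" "\<xi> \<in> partitions 0"
      by (auto simp: partitions_def add_is_1 simp del: sum_mset_0_iff)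
    then show ?thesis using add partitions_0 by simp
  qed
  then show ?thesis by (auto simp: partitions_def)
qed

text \<open>Growth from the single box produces the Pitman law; the normalisers 2, ..., k + 1
  multiply to (k + 1)!. Up steps are peeled off at the inner end, hence the induction over arbitrary
  \<open>g\<close>.\<close>

lemma up_op_power_eq_pitman:
  "(up_op 1 \<alpha> ^^ k) g {#1#} = fact (Suc k) * (\<Sum>y\<in>partitions (Suc k). pitman 1 \<alpha> (Suc k) y * g y)"
proof (induction k arbitrary: g)
  case 0
  show ?case
    using partitions_1 by (simp add: pitman_def)
next
  case (Suc k)
  have "(up_op 1 \<alpha> ^^ Suc k) g {#1#} = (up_op 1 \<alpha> ^^ k) (up_op 1 \<alpha> g) {#1#}"
    by (simp only: funpow_Suc_right o_apply)
  also have "\<dots> = fact (Suc k) * ((1 + real (Suc k)) *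
      (\<Sum>y\<in>partitions (Suc (Suc k)). pitman 1 \<alpha> (Suc (Suc k)) y * g y))"
    unfolding Suc by (subst pitman_up_op) simp_all
  finally show ?case by (simp add: algebra_simps)
qed

text \<open>Every descent from level k + 1 ends in the single box; the factors k + 1, ..., 2 give (k
  + 1)!.\<close>

lemma down_op_power_const:
  assumes "x \<in> partitions (Suc k)"
  shows "(down_op ^^ k) g x = fact (Suc k) * g {#1#}"
  using assms
proof (induction k arbitrary: x)
  case 0
  then show ?case using partitions_1 by simp
next
  case (Suc k)
  have "down_op ((down_op ^^ k) g) x = down_op (\<lambda>_. 0 + fact (Suc k) * g {#1#}) x"
    using Suc.IH by (intro down_op_cong[OF Suc.prems]) simp
  also have "\<dots> = fact (Suc k) * g {#1#} * real (Suc (Suc k))"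
    using sum_parts[OF Suc.prems] by (simp add: down_op_def flip: sum_mset_distrib_right)
  finally show ?case by simp
qed

subsection \<open>Positivity and support\<close>

text \<open>Positivity is asked only at multisets without a part 0: both kinds of move keep this
  property, and it makes each k - \<alpha> nonnegative.\<close>

lemma up_op_nonneg:
  assumes "\<theta> \<ge> 0" "0 \<le> \<alpha>" "\<alpha> \<le> 1" "\<And>\<mu>. 0 \<notin># \<mu> \<Longrightarrow> g \<mu> \<ge> 0" "0 \<notin># \<nu>"
  shows "up_op \<theta> \<alpha> g \<nu> \<ge> 0"
proof -
  have "(real k - \<alpha>) * g (add_box k \<nu>) \<ge> 0" if "k \<in># \<nu>" for k
  proof -
    have "k \<noteq> 0" using that assms(5) by metis
    moreover have "0 \<notin># add_box k \<nu>"
      using that assms(5) by (auto simp: add_box_def dest: in_diffD)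
    ultimately show ?thesis using assms(3,4) by (intro mult_nonneg_nonneg) auto
  qed
  moreover have "0 \<le> (\<theta> + \<alpha> * real (size \<nu>)) * g (add_mset 1 \<nu>)"
    using assms by (intro mult_nonneg_nonneg) auto
  ultimately show ?thesis
    unfolding up_op_def sum_mset_eq_sum_count by (intro add_nonneg_nonneg sum_nonneg) auto
qed

lemma down_op_nonneg:
  assumes "\<And>\<mu>. 0 \<notin># \<mu> \<Longrightarrow> g \<mu> \<ge> 0" "0 \<notin># \<nu>"
  shows "down_op g \<nu> \<ge> 0"
proof -
  have "0 \<notin># remove_box j \<nu>" if "j \<in># \<nu>" for j
  proof -
    have "j \<noteq> 0" using that assms(2) by metis
    then show ?thesis using assms(2) by (auto simp: remove_box_def dest: in_diffD)
  qed
  then show ?thesis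
    unfolding down_op_def sum_mset_eq_sum_count
    by (intro sum_nonneg) (auto intro!: assms(1) mult_nonneg_nonneg)
qed

lemma up_op_power_nonneg:
  assumes "\<theta> \<ge> 0" "0 \<le> \<alpha>" "\<alpha> \<le> 1" "\<And>\<mu>. 0 \<notin># \<mu> \<Longrightarrow> g \<mu> \<ge> 0" "0 \<notin># \<nu>"
  shows "(up_op \<theta> \<alpha> ^^ k) g \<nu> \<ge> 0"
  using assms(5) by (induction k arbitrary: \<nu>) (auto intro!: assms(4) up_op_nonneg[OF assms(1-3)])

lemma down_op_power_nonneg:
  assumes "\<And>\<mu>. 0 \<notin># \<mu> \<Longrightarrow> g \<mu> \<ge> 0" "0 \<notin># \<nu>"
  shows "(down_op ^^ k) g \<nu> \<ge> 0"
  using assms(2) by (induction k arbitrary: \<nu>) (auto intro!: assms(1) down_op_nonneg)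

text \<open>Unreachability in dual form, because the steps act on functions. On partitions, m = 2
  means support on one-column shapes.\<close>

definition vanishes_above :: "nat \<Rightarrow> (nat multiset \<Rightarrow> real) \<Rightarrow> bool" where
  "vanishes_above m g \<longleftrightarrow> (\<forall>\<nu>. (\<exists>p\<in>#\<nu>. p \<ge> m) \<longrightarrow> g \<nu> = 0)"

lemma vanishes_above_up_op:
  assumes g: "vanishes_above m g"
  shows "vanishes_above m (up_op \<theta> \<alpha> g)"
  unfolding vanishes_above_def
proof (intro allI impI)
  fix \<nu> :: "nat multiset" assume "\<exists>p\<in>#\<nu>. p \<ge> m"
  then obtain p where p: "p \<in># \<nu>" "p \<ge> m" by blast
  have "g (add_box k \<nu>) = 0" if "k \<in># \<nu>" for k
  proof -
    have "\<exists>q\<in>#add_box k \<nu>. q \<ge> m"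
      using p by (cases "k = p") (auto simp: add_box_def in_diff_count intro!: bexI[of _ p])
    then show ?thesis using g by (auto simp: vanishes_above_def)
  qed
  moreover have "\<exists>q\<in>#add_mset 1 \<nu>. q \<ge> m" using p by auto
  then have "g (add_mset 1 \<nu>) = 0" using g unfolding vanishes_above_def by blast
  ultimately show "up_op \<theta> \<alpha> g \<nu> = 0" by (simp add: up_op_def sum_mset_eq_sum_count)
qed

text \<open>A down step shortens a row by at most one. With m \<ge> 1 a row longer than m has at
  least two boxes and so does not disappear.\<close>

lemma vanishes_above_down_op:
  assumes g: "vanishes_above m g" and m: "m \<ge> 1"
  shows "vanishes_above (Suc m) (down_op g)"
  unfolding vanishes_above_def
proof (intro allI impI)
  fix \<nu> :: "nat multiset" assume "\<exists>p\<in>#\<nu>. p \<ge> Suc m"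
  then obtain p where p: "p \<in># \<nu>" "p \<ge> Suc m" by blast
  have "g (remove_box j \<nu>) = 0" if "j \<in># \<nu>" for j
  proof -
    have "\<exists>q\<in>#remove_box j \<nu>. q \<ge> m"
      using p m by (cases "j = p") (auto simp: remove_box_def in_diff_count intro!: bexI[of _ p])
    then show ?thesis using g by (auto simp: vanishes_above_def)
  qed
  then show "down_op g \<nu> = 0" by (simp add: down_op_def sum_mset_eq_sum_count)
qed

lemma vanishes_above_power:
  assumes "vanishes_above m g" "m \<ge> 1"
  shows "vanishes_above (m + k) ((down_op ^^ k) ((up_op \<theta> \<alpha> ^^ l) g))"
proof -
  have "vanishes_above m ((up_op \<theta> \<alpha> ^^ l) g)"
    by (induction l) (auto intro: assms vanishes_above_up_op)
  then show ?thesis using assms(2)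
    by (induction k) (auto intro: vanishes_above_down_op)
qed

subsection \<open>A pure death chain\<close>

text \<open>For i \<le> m this is the binomial ratio (2m choose m + i) / (2m choose m). For i > m
  truncated subtraction leaves a nonzero value, so sums over i stop at m.\<close>

definition death_coeff :: "nat \<Rightarrow> nat \<Rightarrow> real" where
  "death_coeff m i = (fact m)\<^sup>2 / (fact (m - i) * fact (m + i))"

text \<open>As a function of the level, \<open>death_coeff\<close> is an eigenvector of the death
  chain: this is the eigenvalue equation for 1 - i^2/n^2, with n^2 cleared.\<close>

lemma death_coeff_Suc_left:
  assumes "i \<le> m"
  shows "death_coeff (Suc m) i * ((real (Suc m))\<^sup>2 - (real i)\<^sup>2) = (real (Suc m))\<^sup>2 * death_coeff m i"
proof -
  have "real (Suc m) - real i > 0" "real (Suc m) + real i > 0" using assms by auto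
  moreover have "fact (Suc m - i) = (real (Suc m) - real i) * fact (m - i)"
    using assms by (simp add: Suc_diff_le of_nat_diff)
  moreover have "fact (Suc m + i) = (real (Suc m) + real i) * fact (m + i)" by simp
  ultimately show ?thesis
    unfolding death_coeff_def square_diff_square_factored power2_eq_square
    by (simp only: fact_Suc of_nat_mult) (simp add: divide_simps del: of_nat_Suc fact_Suc)
qed

text \<open>The ratio lies in [0, 1] and tends to 1 as m grows; induction on i then gives both the
  bound and the limit of \<open>death_coeff\<close>.\<close>

lemma death_coeff_Suc_right:
  assumes "i < m"
  shows "death_coeff m (Suc i) = death_coeff m i * ((real m - real i) / (real m + real i + 1))"
proof -
  have "fact (m - i) = (real m - real i) * fact (m - Suc i)"
    using assms by (simp add: fact_reduce[of "m - i"] of_nat_diff)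
  moreover have "real m - real i > 0" using assms by simp
  ultimately show ?thesis
    unfolding death_coeff_def by (simp add: divide_simps)
qed

lemma death_coeff_0: "death_coeff m 0 = 1"
  by (simp add: death_coeff_def power2_eq_square)

lemma death_coeff_bounds:
  assumes "i \<le> m"
  shows "0 \<le> death_coeff m i" "death_coeff m i \<le> 1"
proof -
  show "0 \<le> death_coeff m i" by (simp add: death_coeff_def)
  show "death_coeff m i \<le> 1" using assms
  proof (induction i)
    case (Suc i)
    define b where "b = (real m - real i) / (real m + real i + 1)"
    have "0 \<le> b" "b \<le> 1" using Suc.prems by (auto simp: b_def)
    with Suc show ?case
      using death_coeff_Suc_right[of i m, folded b_def] mult_le_one[of "death_coeff m i" b] by simp
  qed (simp add: death_coeff_0)
qed

lemma death_coeff_tendsto: "(\<lambda>m. death_coeff m i) \<longlonglongrightarrow> 1"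
proof (induction i)
  case (Suc i)
  have "(\<lambda>m. (real m - real i) / (real m + real i + 1)) \<longlonglongrightarrow> 1" by real_asymp
  from tendsto_mult[OF Suc this]
  have "(\<lambda>m. death_coeff m i * ((real m - real i) / (real m + real i + 1))) \<longlonglongrightarrow> 1" by simp
  moreover have "\<forall>\<^sub>F m in sequentially.
      death_coeff m i * ((real m - real i) / (real m + real i + 1)) = death_coeff m (Suc i)"
    using eventually_gt_at_top[of i] by eventually_elim (simp add: death_coeff_Suc_right)
  ultimately show ?case by (rule Lim_transform_eventually)
qed (simp add: death_coeff_0)

text \<open>For the pure death chain on \<open>{1..n}\<close> that moves from \<open>m\<close> to \<open>m - 1\<close> with probability
  \<open>m\<^sup>2 / n\<^sup>2\<close>, this is the probability of not having reached \<open>1\<close> after \<open>r\<close> steps from \<open>m\<close>.\<close>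

definition death_tail :: "nat \<Rightarrow> nat \<Rightarrow> nat \<Rightarrow> real" where
  "death_tail n m r = 2 * (\<Sum>i=2..m. (-1) ^ i * ((real i)\<^sup>2 - 1) * death_coeff m i
     * (1 - (real i)\<^sup>2 / (real n)\<^sup>2) ^ r)"

lemma death_tail_1: "death_tail n 1 r = 0"
  by (simp add: death_tail_def)

text \<open>First-step equation of the death chain, verified term by term from the eigenvalue
  equation.\<close>

lemma death_tail_Suc:
  assumes "n \<ge> 1"
  shows "death_tail n (Suc m) (Suc r) = (1 - (real (Suc m))\<^sup>2 / (real n)\<^sup>2) * death_tail n (Suc m) r
    + (real (Suc m))\<^sup>2 / (real n)\<^sup>2 * death_tail n m r"
proof -
  define w where "w i = (-1) ^ i * ((real i)\<^sup>2 - 1) * (1 - (real i)\<^sup>2 / (real n)\<^sup>2) ^ r" for i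
  define q where "q i = (real i)\<^sup>2 / (real n)\<^sup>2" for i
  have h: "death_tail n k r = 2 * (\<Sum>i=2..k. w i * death_coeff k i)" for k
    unfolding death_tail_def w_def by (simp add: mult_ac)
  have hS: "death_tail n k (Suc r) = 2 * (\<Sum>i=2..k. w i * death_coeff k i * (1 - q i))" for k
    unfolding death_tail_def w_def q_def by (simp add: mult_ac)
  \<comment> \<open>The term i = m + 1 drops out because its last factor is zero.\<close>
  have "(\<Sum>i=2..Suc m. w i * death_coeff (Suc m) i * (q (Suc m) - q i))
      = (\<Sum>i=2..m. w i * death_coeff (Suc m) i * (q (Suc m) - q i))"
    by (rule sum.mono_neutral_right) (auto simp: le_Suc_eq)
  also have "\<dots> = (\<Sum>i=2..m. q (Suc m) * (w i * death_coeff m i))"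
  proof (rule sum.cong)
    fix i assume "i \<in> {2..m}"
    then have "death_coeff (Suc m) i * ((real (Suc m))\<^sup>2 - (real i)\<^sup>2)
        = (real (Suc m))\<^sup>2 * death_coeff m i"
      by (intro death_coeff_Suc_left) simp
    then have "death_coeff (Suc m) i * (q (Suc m) - q i) = q (Suc m) * death_coeff m i"
      unfolding q_def diff_divide_distrib[symmetric] by (simp del: of_nat_Suc)
    then show "w i * death_coeff (Suc m) i * (q (Suc m) - q i) = q (Suc m) * (w i * death_coeff m i)"
      by (simp add: mult_ac)
  qed simp
  finally have key: "(\<Sum>i=2..Suc m. w i * death_coeff (Suc m) i * (q (Suc m) - q i))
      = q (Suc m) * (\<Sum>i=2..m. w i * death_coeff m i)"
    by (simp add: sum_distrib_left)
  have "(\<Sum>i=2..Suc m. w i * death_coeff (Suc m) i * (1 - q i))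
      = (\<Sum>i=2..Suc m. (1 - q (Suc m)) * (w i * death_coeff (Suc m) i)
           + w i * death_coeff (Suc m) i * (q (Suc m) - q i))"
    by (intro sum.cong refl) (simp add: algebra_simps)
  also have "\<dots> = (1 - q (Suc m)) * (\<Sum>i=2..Suc m. w i * death_coeff (Suc m) i)
      + q (Suc m) * (\<Sum>i=2..m. w i * death_coeff m i)"
    unfolding sum.distrib key by (simp only: sum_distrib_left)
  finally show ?thesis
    unfolding h hS q_def[symmetric] by (simp add: distrib_left del: sum.cl_ivl_Suc)
qed

text \<open>A chain started at m \<ge> 2 has not reached 1 at time 0. In the partial sum up to j the
  deviation from 1 carries the factor m - j, which vanishes at j = m.\<close>

lemma death_tail_0:
  assumes m: "m \<ge> 2"
  shows "death_tail n m 0 = 1"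
proof -
  define q where "q x = 1 / (2 * real m) - x * (x + 1) / (2 * (real m - 1))" for x
  \<comment> \<open>Gosper's algorithm supplies the closed form of the partial sums.\<close>
  have "2 * (\<Sum>i=2..j. (-1) ^ i * ((real i)\<^sup>2 - 1) * death_coeff m i)
      = 1 - 2 * (-1) ^ j * q (real j) * (real m - real j) * death_coeff m j"
    if "1 \<le> j" "j \<le> m" for j
    using that
  proof (induction j rule: dec_induct)
    case base
    \<comment> \<open>The sum from 2 to 1 is empty, so the closed form has to vanish at j =
      1.\<close>
    have "death_coeff m 1 = real m / (real m + 1)"
      using death_coeff_Suc_right[of 0 m] m by (simp add: death_coeff_0)
    moreover have "q 1 * (real m - 1) = - (real m + 1) / (2 * real m)"
      using m by (simp add: q_def divide_simps) (simp add: algebra_simps)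
    then have "q 1 * (real m - 1) * (real m / (real m + 1)) = - 1 / 2"
      using m by (simp only:) (simp add: divide_simps)
    ultimately show ?case by simp
  next
    case (step j)
    define s where "s = (-1::real) ^ j"
    define A where "A = death_coeff m j * ((real m - real j) / (real m + real j + 1))"
    have pos: "real m + real j + 1 > 0" "real m > 1" using m by auto
    have A: "death_coeff m (Suc j) = A"
      unfolding A_def using step.prems by (intro death_coeff_Suc_right) simp
    have A2: "(real m - real j) * death_coeff m j = A * (real m + real j + 1)"
      unfolding A_def using pos by (simp add: field_simps)
    \<comment> \<open>With both terms written as multiples of \<open>A\<close>, telescoping amounts
      to this identity.\<close>
    have q: "q (real j) * (real m + real j + 1) + ((real j + 1)\<^sup>2 - 1)
        = - q (real j + 1) * (real m - real j - 1)"
      unfolding q_def using pos by (simp add: divide_simps) (simp add: algebra_simps power2_eq_square)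
    have "2 * (\<Sum>i=2..Suc j. (-1) ^ i * ((real i)\<^sup>2 - 1) * death_coeff m i)
        = 2 * (\<Sum>i=2..j. (-1) ^ i * ((real i)\<^sup>2 - 1) * death_coeff m i)
          - 2 * s * ((real j + 1)\<^sup>2 - 1) * A"
      using step.hyps by (simp add: A s_def algebra_simps)
    also have "\<dots> = 1 - 2 * s * q (real j) * ((real m - real j) * death_coeff m j)
          - 2 * s * ((real j + 1)\<^sup>2 - 1) * A"
      using step by (simp add: s_def mult.assoc)
    also have "\<dots> = 1 - 2 * s * A * (q (real j) * (real m + real j + 1) + ((real j + 1)\<^sup>2 - 1))"
      unfolding A2 by (simp add: algebra_simps)
    also have "\<dots> = 1 - 2 * (-1) ^ Suc j * q (real (Suc j)) * (real m - real (Suc j)) * death_coeff m (Suc j)"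
      unfolding q A by (simp add: s_def algebra_simps)
    finally show ?case .
  qed
  from this[of m] show ?thesis using m by (simp add: death_tail_def)
qed

section \<open>The limit on the time scale n^2\<close>

text \<open>Tannery's theorem: the terms converge for each fixed i and are dominated by the summable
  \<open>M\<close>.\<close>

lemma death_tail_diagonal_tendsto:
  fixes c :: real
  assumes c: "c > 0"
  shows "(\<lambda>i::nat. (-1) ^ i * ((real i)\<^sup>2 - 1) * exp (- c * (real i)\<^sup>2)) summable_on {2..}"
    and "(\<lambda>n. death_tail n n (nat \<lfloor>c * (real n)\<^sup>2\<rfloor>))
      \<longlonglongrightarrow> 2 * (\<Sum>\<^sub>\<infinity>i\<in>{2..}. (-1) ^ i * ((real i)\<^sup>2 - 1) * exp (- c * (real i)\<^sup>2))"
proof -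
  define N where "N n = nat \<lfloor>c * (real n)\<^sup>2\<rfloor>" for n
  define w where "w i = (-1) ^ i * ((real i)\<^sup>2 - 1)" for i :: nat
  define a where "a i n = (if 2 \<le> i \<and> i \<le> n
    then w i * death_coeff n i * (1 - (real i)\<^sup>2 / (real n)\<^sup>2) ^ N n else 0)" for i n
  define b where "b i = (if 2 \<le> i then w i * exp (- c * (real i)\<^sup>2) else 0)" for i
  \<comment> \<open>The 1 in the exponent pays for the floor: \<open>N n\<close> falls short of c
    n^2 by at most 1, and this loss is multiplied by i^2/n^2 \<le> 1.\<close>
  define M where "M i = (real i)\<^sup>2 * exp (1 - c * (real i)\<^sup>2)" for i
  have N_lower: "c * (real n)\<^sup>2 - 1 \<le> real (N n)" and N_upper: "real (N n) \<le> c * (real n)\<^sup>2" for n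
    unfolding N_def using c by (auto simp: of_nat_nat)
  have lim: "a i \<longlonglongrightarrow> b i" for i
  proof (cases "2 \<le> i")
    case True
    have sq: "(\<lambda>n. real (N n) / (real n)\<^sup>2) \<longlonglongrightarrow> c"
    proof (rule tendsto_sandwich)
      show "(\<lambda>n. c - 1 / (real n)\<^sup>2) \<longlonglongrightarrow> c" by real_asymp
      show "\<forall>\<^sub>F n in sequentially. c - 1 / (real n)\<^sup>2 \<le> real (N n) / (real n)\<^sup>2"
        using eventually_gt_at_top[of 0]
      proof eventually_elim
        case (elim n)
        then show ?case
          using divide_right_mono[OF N_lower[of n], of "(real n)\<^sup>2"] by (simp add: diff_divide_distrib)
      qed
      show "\<forall>\<^sub>F n in sequentially. real (N n) / (real n)\<^sup>2 \<le> c"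
        using eventually_gt_at_top[of 0]
        by eventually_elim (use N_upper in \<open>simp add: field_simps\<close>)
    qed simp
    \<comment> \<open>The power is written as exp of N/n^2 times n^2 ln(1 - i^2/n^2); these two
      factors tend to c and -i^2.\<close>
    have "(\<lambda>n. (real n)\<^sup>2 * ln (1 - d / (real n)\<^sup>2)) \<longlonglongrightarrow> - d" if "d > 0" for d :: real
      using that by real_asymp
    from this[of "(real i)\<^sup>2"]
    have "(\<lambda>n. real (N n) / (real n)\<^sup>2 * ((real n)\<^sup>2 * ln (1 - (real i)\<^sup>2 / (real n)\<^sup>2)))
        \<longlonglongrightarrow> c * - (real i)\<^sup>2"
      using True by (intro tendsto_mult sq) simp
    from tendsto_mult[OF tendsto_mult[OF tendsto_const death_coeff_tendsto] tendsto_exp[OF this]]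
    have "(\<lambda>n. w i * death_coeff n i *
        exp (real (N n) / (real n)\<^sup>2 * ((real n)\<^sup>2 * ln (1 - (real i)\<^sup>2 / (real n)\<^sup>2))))
        \<longlonglongrightarrow> w i * 1 * exp (c * - (real i)\<^sup>2)" .
    moreover have "\<forall>\<^sub>F n in sequentially. w i * death_coeff n i *
        exp (real (N n) / (real n)\<^sup>2 * ((real n)\<^sup>2 * ln (1 - (real i)\<^sup>2 / (real n)\<^sup>2))) = a i n"
      using eventually_gt_at_top[of i]
    proof eventually_elim
      case (elim n)
      \<comment> \<open>Strictness of i < n keeps the argument of the logarithm positive.\<close>
      then have "(real i)\<^sup>2 / (real n)\<^sup>2 < 1" by (simp add: power_strict_mono)
      then have "exp (real (N n) * ln (1 - (real i)\<^sup>2 / (real n)\<^sup>2))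
          = (1 - (real i)\<^sup>2 / (real n)\<^sup>2) ^ N n"
        by (simp add: exp_of_nat_mult)
      with elim True show ?case by (simp add: a_def)
    qed
    ultimately show ?thesis
      using True by (simp add: b_def) (rule Lim_transform_eventually)
  next
    case False
    then have "a i = (\<lambda>_. 0)" "b i = 0" by (auto simp: a_def b_def)
    then show ?thesis by simp
  qed
  have bound: "norm (a i n) \<le> M i" for i n
  proof (cases "2 \<le> i \<and> i \<le> n")
    case True
    define u where "u = (real i)\<^sup>2 / (real n)\<^sup>2"
    have u: "0 \<le> u" "u \<le> 1" using True by (auto simp: u_def power_mono)
    have "(1 - u) ^ N n \<le> exp (- u) ^ N n"
      using u exp_ge_add_one_self[of "- u"] by (intro power_mono) auto
    also have "\<dots> = exp (- (u * real (N n)))" by (simp flip: exp_of_nat_mult)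
    also have "\<dots> \<le> exp (- (u * (c * (real n)\<^sup>2 - 1)))"
      using mult_left_mono[OF N_lower u(1)] by simp
    also have "u * (c * (real n)\<^sup>2 - 1) = c * (real i)\<^sup>2 - u"
      using True by (simp add: u_def field_simps)
    also have "exp (- (c * (real i)\<^sup>2 - u)) \<le> exp (1 - c * (real i)\<^sup>2)" using u by simp
    finally have pow: "(1 - u) ^ N n \<le> exp (1 - c * (real i)\<^sup>2)" .
    have "\<bar>w i\<bar> \<le> (real i)\<^sup>2"
      using True by (simp add: w_def abs_mult power_abs)
    moreover have "\<bar>death_coeff n i\<bar> \<le> 1" using death_coeff_bounds[of i n] True by simp
    ultimately have "\<bar>w i\<bar> * \<bar>death_coeff n i\<bar> * (1 - u) ^ N n
        \<le> ((real i)\<^sup>2 * 1) * exp (1 - c * (real i)\<^sup>2)"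
      using u pow by (intro mult_mono) auto
    then show ?thesis using True u by (simp add: a_def M_def u_def[symmetric] abs_mult power_abs)
  qed (auto simp: a_def M_def)
  have "summable M"
  proof (rule summable_comparison_test_bigo)
    show "summable (\<lambda>i. norm (1 / (real i)\<^sup>2))"
      using inverse_power_summable[of 2, where 'a = real] by (simp add: divide_inverse)
    show "M \<in> O(\<lambda>i. 1 / (real i)\<^sup>2)" unfolding M_def using c by real_asymp
  qed
  then have tannery: "summable (\<lambda>i. norm (b i)) \<and> (\<lambda>n. suminf (\<lambda>i. a i n)) \<longlonglongrightarrow> suminf b"
    using tannerys_theorem[of a b sequentially M] lim bound by (auto simp: always_eventually)
  then have sb: "summable (\<lambda>i. norm (b i))" by simp
  have "(b has_sum suminf b) UNIV"
    by (rule norm_summable_imp_has_sum[OF sb summable_sums[OF summable_norm_cancel[OF sb]]])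
  then have hs: "((\<lambda>i. w i * exp (- c * (real i)\<^sup>2)) has_sum suminf b) {2..}"
    by (rule has_sum_cong_neutral[THEN iffD1, rotated -1]) (auto simp: b_def)
  then show "(\<lambda>i::nat. (-1) ^ i * ((real i)\<^sup>2 - 1) * exp (- c * (real i)\<^sup>2)) summable_on {2..}"
    by (auto simp: summable_on_def w_def)
  have "death_tail n n (N n) = 2 * suminf (\<lambda>i. a i n)" for n
  proof -
    have "suminf (\<lambda>i. a i n) = (\<Sum>i=2..n. a i n)" by (rule suminf_finite) (auto simp: a_def)
    also have "\<dots> = (\<Sum>i=2..n. w i * death_coeff n i * (1 - (real i)\<^sup>2 / (real n)\<^sup>2) ^ N n)"
      by (intro sum.cong) (auto simp: a_def)
    finally show ?thesis by (simp add: death_tail_def w_def)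
  qed
  then have "(\<lambda>n. death_tail n n (N n)) \<longlonglongrightarrow> 2 * suminf b"
    using tannery by (auto intro: tendsto_mult)
  moreover have "suminf b = (\<Sum>\<^sub>\<infinity>i\<in>{2..}. w i * exp (- c * (real i)\<^sup>2))"
    using infsumI[OF hs] by simp
  ultimately show "(\<lambda>n. death_tail n n (nat \<lfloor>c * (real n)\<^sup>2\<rfloor>))
      \<longlonglongrightarrow> 2 * (\<Sum>\<^sub>\<infinity>i\<in>{2..}. (-1) ^ i * ((real i)\<^sup>2 - 1) * exp (- c * (real i)\<^sup>2))"
    by (simp add: N_def w_def)
qed

subsection \<open>Separation distance\<close>

definition kernel_op :: "'a set \<Rightarrow> ('a \<Rightarrow> 'a \<Rightarrow> real) \<Rightarrow> ('a \<Rightarrow> real) \<Rightarrow> 'a \<Rightarrow> real" where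
  "kernel_op S K g x = (\<Sum>z\<in>S. K x z * g z)"

lemma kernel_power_eq_kernel_op:
  "kernel_power S K r x y = (kernel_op S K ^^ r) (\<lambda>z. if z = y then 1 else 0) x"
  by (induction r arbitrary: x) (simp_all add: kernel_op_def)

lemma kernel_op_power_cong:
  assumes "\<And>z. z \<in> S \<Longrightarrow> f z = g z" "x \<in> S"
  shows "(kernel_op S K ^^ r) f x = (kernel_op S K ^^ r) g x"
  using assms(2) by (induction r arbitrary: x) (simp_all add: assms(1) kernel_op_def)

lemma kernel_op_power_lincomb:
  "(kernel_op S K ^^ r) (\<lambda>z. a * f z + b * g z) x
    = a * (kernel_op S K ^^ r) f x + b * (kernel_op S K ^^ r) g x"
  by (induction r arbitrary: x)
    (simp_all add: kernel_op_def sum.distrib distrib_left sum_distrib_left mult_ac)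

text \<open>By \<open>rec\<close> and linearity, K^r applied to \<open>T m\<close> is a mixture of
  the \<open>T k\<close>, weighted by the law of the death chain after r steps from m. Level 1
  contributes p times the probability of having reached it; the other terms are nonnegative, and
  zero in the equality case.\<close>

lemma kernel_op_power_death:
  assumes n: "n \<ge> 1" and x: "x \<in> S"
    and rec: "\<And>m z. 1 \<le> m \<Longrightarrow> m \<le> n \<Longrightarrow> z \<in> S \<Longrightarrow> kernel_op S K (T m) z
      = (1 - (real m)\<^sup>2 / (real n)\<^sup>2) * T m z + (real m)\<^sup>2 / (real n)\<^sup>2 * T (m - 1) z"
    and T0: "\<And>z. z \<in> S \<Longrightarrow> T 0 z = T 1 z" and T1: "T 1 x = p"
    and nonneg: "\<And>m. T m x \<ge> 0"
    and m: "1 \<le> m" "m \<le> n"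
  shows "(1 - death_tail n m r) * p \<le> (kernel_op S K ^^ r) (T m) x \<and>
    ((\<forall>k\<in>{2..n}. T k x = 0) \<longrightarrow> (kernel_op S K ^^ r) (T m) x = (1 - death_tail n m r) * p)"
  using m
proof (induction r arbitrary: m)
  case 0
  show ?case
  proof (cases "m = 1")
    case True
    then show ?thesis using T1 death_tail_1[of n 0] by simp
  next
    case False
    then show ?thesis using 0 nonneg[of m] by (simp add: death_tail_0)
  qed
next
  case (Suc r)
  define q where "q = (real m)\<^sup>2 / (real n)\<^sup>2"
  define V where "V = (\<lambda>m. (kernel_op S K ^^ r) (T m) x)"
  have q: "0 \<le> q" "q \<le> 1" using Suc.prems n by (auto simp: q_def power_mono)
  \<comment> \<open>The innermost application is peeled off, so that \<open>rec\<close> acts on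
    \<open>T m\<close> itself.\<close>
  have step: "(kernel_op S K ^^ Suc r) (T m) x = (1 - q) * V m + q * V (m - 1)"
    unfolding funpow_Suc_right o_apply V_def kernel_op_power_lincomb[symmetric]
    by (rule kernel_op_power_cong) (use Suc.prems rec x in \<open>auto simp: q_def\<close>)
  have IH: "(1 - death_tail n k r) * p \<le> V k"
    "(\<forall>k\<in>{2..n}. T k x = 0) \<Longrightarrow> V k = (1 - death_tail n k r) * p" if "1 \<le> k" "k \<le> n" for k
    using Suc.IH[OF that] by (auto simp: V_def)
  show ?case
  proof (cases "m = 1")
    case True
    \<comment> \<open>At m = 1 \<open>rec\<close> still moves mass to \<open>T 0\<close>; as this
      agrees with \<open>T 1\<close>, level 1 is in effect absorbing.\<close>
    have "V 0 = V 1" unfolding V_def using T0 x by (intro kernel_op_power_cong) auto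
    then have "(kernel_op S K ^^ Suc r) (T m) x = V 1" using step True by (simp add: algebra_simps)
    then show ?thesis using IH[of 1] n True death_tail_1[of n] by simp
  next
    case False
    then obtain k where k: "m = Suc k" "1 \<le> k" "k \<le> n" using Suc.prems by (cases m) auto
    have "death_tail n m (Suc r) = (1 - q) * death_tail n m r + q * death_tail n k r"
      using death_tail_Suc[OF n, of k r] by (simp only: q_def k(1))
    then have "(1 - death_tail n m (Suc r)) * p
        = (1 - q) * ((1 - death_tail n m r) * p) + q * ((1 - death_tail n k r) * p)"
      by (simp only:) (simp add: algebra_simps)
    then show ?thesis
      unfolding step using IH[OF Suc.prems] IH[OF k(2,3)] q
      by (auto simp: k(1) intro!: add_mono mult_left_mono)
  qed
qed

text \<open>The probability of going from \<open>x\<close> on level \<open>n\<close> to \<open>y\<close> by \<open>n - m\<close> down steps followed by \<open>n - m\<close>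
  up steps; the squared factor normalises the operators and is right only for \<open>\<theta> = 1\<close>.\<close>

definition down_up_level :: "real \<Rightarrow> nat \<Rightarrow> nat multiset \<Rightarrow> nat \<Rightarrow> nat multiset \<Rightarrow> real" where
  "down_up_level \<alpha> n y m x = (fact m / fact n)\<^sup>2 *
     (down_op ^^ (n - m)) ((up_op 1 \<alpha> ^^ (n - m)) (\<lambda>z. if z = y then 1 else 0)) x"

text \<open>This is \<open>down_up_power\<close> at \<theta> = 1, divided by n(\<theta> + n - 1) =
  n^2. The factor m^2 is the change of the squared factorial between levels m - 1 and m.\<close>

lemma down_up_level_rec:
  assumes n: "n \<ge> 1" and m: "1 \<le> m" "m \<le> n" and x: "x \<in> partitions n"
  shows "kernel_op (partitions n) (down_up_walk 1 \<alpha> n) (down_up_level \<alpha> n y m) x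
    = (1 - (real m)\<^sup>2 / (real n)\<^sup>2) * down_up_level \<alpha> n y m x
      + (real m)\<^sup>2 / (real n)\<^sup>2 * down_up_level \<alpha> n y (m - 1) x"
proof -
  define F where "F k = (down_op ^^ k) ((up_op 1 \<alpha> ^^ k) (\<lambda>z. if z = y then 1 else 0))" for k
  define c where "c = (fact m / fact n :: real)\<^sup>2"
  have lev: "down_up_level \<alpha> n y m = (\<lambda>z. c * F (n - m) z)"
    by (simp add: down_up_level_def c_def F_def fun_eq_iff)
  have k: "n - (m - 1) = Suc (n - m)" using m by simp
  have fm: "(fact m / fact n :: real)\<^sup>2 = (real m)\<^sup>2 * (fact (m - 1) / fact n)\<^sup>2"
    using m by (simp add: fact_reduce[of m] power_mult_distrib power_divide)
  have lev1: "(real m)\<^sup>2 * down_up_level \<alpha> n y (m - 1) x = c * F (Suc (n - m)) x"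
    by (simp only: down_up_level_def k c_def F_def fm mult.assoc)
  have du: "down_op (up_op 1 \<alpha> (F (n - m))) x
      = F (Suc (n - m)) x + ((real n)\<^sup>2 - (real m)\<^sup>2) * F (n - m) x"
    using down_up_power[OF x, of 1 \<alpha> "n - m"] m
    by (simp add: F_def of_nat_diff power2_eq_square algebra_simps)
  have "kernel_op (partitions n) (down_up_walk 1 \<alpha> n) (down_up_level \<alpha> n y m) x
      = down_op (up_op 1 \<alpha> (\<lambda>z. c * F (n - m) z)) x / (real n)\<^sup>2"
    unfolding kernel_op_def sum_down_up_walk[OF x n] lev by (simp add: power2_eq_square)
  also have "up_op 1 \<alpha> (\<lambda>z. c * F (n - m) z) = (\<lambda>z. 0 + c * up_op 1 \<alpha> (F (n - m)) z)"
    by (simp add: up_op_cmult fun_eq_iff)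
  also have "down_op \<dots> x = c * down_op (up_op 1 \<alpha> (F (n - m))) x"
    by (subst down_op_lincomb) (simp add: down_op_def)
  finally show ?thesis
    using lev1 n unfolding du lev by (simp add: field_simps)
qed

text \<open>All paths pass through the single box, which erases x; growth from there has the Pitman
  law.\<close>

lemma down_up_level_1:
  assumes n: "n \<ge> 1" and x: "x \<in> partitions n" and y: "y \<in> partitions n"
  shows "down_up_level \<alpha> n y 1 x = pitman 1 \<alpha> n y"
proof -
  obtain k where k: "n = Suc k" using n by (cases n) auto
  have "(up_op 1 \<alpha> ^^ k) (\<lambda>z. if z = y then 1 else 0) {#1#} = fact n * pitman 1 \<alpha> n y"
    unfolding up_op_power_eq_pitman k[symmetric]
    using y by (simp add: sum.delta finite_partitions if_distrib[of "(*) _"] cong: if_cong)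
  then show ?thesis
    using down_op_power_const[of x k] x
    by (simp add: down_up_level_def k power2_eq_square del: fact_Suc)
qed

text \<open>Going from the single box to the empty partition and back has weight \<theta> = 1, so
  one further descent changes nothing.\<close>

lemma down_up_level_0:
  assumes n: "n \<ge> 1" and x: "x \<in> partitions n"
  shows "down_up_level \<alpha> n y 0 x = down_up_level \<alpha> n y 1 x"
proof -
  obtain k where k: "n = Suc k" using n by (cases n) auto
  let ?g = "(up_op 1 \<alpha> ^^ k) (\<lambda>z. if z = y then 1 else 0)"
  have "(down_op ^^ Suc k) (up_op 1 \<alpha> ?g) x = fact n * down_op (up_op 1 \<alpha> ?g) {#1#}"
    using down_op_power_const[of x k] x unfolding funpow_Suc_right o_apply k by simp
  also have "down_op (up_op 1 \<alpha> ?g) {#1#} = ?g {#1#}"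
    by (simp add: down_op_def up_op_def remove_box_def)
  finally show ?thesis
    using down_op_power_const[of x k ?g] x by (simp add: down_up_level_def k del: fact_Suc)
qed

lemma down_up_level_nonneg:
  assumes "0 \<le> \<alpha>" "\<alpha> < 1" "x \<in> partitions n"
  shows "down_up_level \<alpha> n y m x \<ge> 0"
  unfolding down_up_level_def using assms
  by (intro mult_nonneg_nonneg down_op_power_nonneg up_op_power_nonneg) (auto simp: partitions_def)

text \<open>Started from the one-row partition, the down steps keep a part of size \<open>m \<ge> 2\<close> down to
  level \<open>m\<close>, and up steps never split parts, so the one-column partition is unreachable.\<close>

lemma down_up_level_row_column:
  assumes m: "2 \<le> m" "m \<le> n"
  shows "down_up_level \<alpha> n (replicate_mset n 1) m {#n#} = 0"
proof -
  have "vanishes_above 2 (\<lambda>z. if z = replicate_mset n 1 then 1 else 0)"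
    by (auto simp: vanishes_above_def)
  from vanishes_above_power[OF this, where k = "n - m" and l = "n - m" and \<theta> = 1 and \<alpha> = \<alpha>]
  show ?thesis using m by (auto simp: vanishes_above_def down_up_level_def)
qed

text \<open>The lower bound on K^r / \<pi> holds for every pair and bounds the separation from
  above; the pair of one-row and one-column partitions attains it.\<close>

lemma kingman_separation_eq_death_tail:
  assumes \<alpha>: "0 \<le> \<alpha>" "\<alpha> < 1" and n: "n \<ge> 1"
  shows "kingman_separation 1 \<alpha> n r = death_tail n n r"
proof -
  let ?S = "partitions n" and ?K = "down_up_walk 1 \<alpha> n"
  let ?s = "\<lambda>(x, y). 1 - kernel_power ?S ?K r x y / pitman 1 \<alpha> n y"
  \<comment> \<open>At m = n no steps are taken, so this level is the point indicator from which the
    kernel power starts.\<close>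
  have top: "down_up_level \<alpha> n y n = (\<lambda>z. if z = y then 1 else 0)" for y
    by (simp add: down_up_level_def fun_eq_iff)
  have main: "(1 - death_tail n n r) * pitman 1 \<alpha> n y \<le> kernel_power ?S ?K r x y \<and>
      ((\<forall>k\<in>{2..n}. down_up_level \<alpha> n y k x = 0) \<longrightarrow>
        kernel_power ?S ?K r x y = (1 - death_tail n n r) * pitman 1 \<alpha> n y)"
    if "x \<in> ?S" "y \<in> ?S" for x y
    unfolding kernel_power_eq_kernel_op top[symmetric]
    using n down_up_level_0[OF n] down_up_level_1[OF n that] down_up_level_nonneg[OF \<alpha> that(1)]
      down_up_level_rec[OF n] that(1)
    by (intro kernel_op_power_death) auto
  \<comment> \<open>For n = 1 the two coincide, and the set {2..n} of levels to check is
    empty.\<close>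
  let ?x = "{#n#}" and ?y = "replicate_mset n (1::nat)"
  have xy: "?x \<in> ?S" "?y \<in> ?S"
    using n by (auto simp: partitions_def)
  have "Max (?s ` (?S \<times> ?S)) = death_tail n n r"
  proof (rule Max_eqI)
    show "finite (?s ` (?S \<times> ?S))" by (simp add: finite_partitions)
    show "s \<le> death_tail n n r" if "s \<in> ?s ` (?S \<times> ?S)" for s
    proof -
      obtain x y where *: "x \<in> ?S" "y \<in> ?S" "s = 1 - kernel_power ?S ?K r x y / pitman 1 \<alpha> n y"
        using \<open>s \<in> ?s ` (?S \<times> ?S)\<close> by auto
      show ?thesis
        using main[OF *(1,2)] pitman_pos[OF *(2) _ \<alpha>, of 1] by (simp add: *(3) field_simps)
    qed
    have "kernel_power ?S ?K r ?x ?y = (1 - death_tail n n r) * pitman 1 \<alpha> n ?y"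
      using main[OF xy] down_up_level_row_column by auto
    then have "?s (?x, ?y) = death_tail n n r"
      using pitman_pos[OF xy(2) _ \<alpha>, of 1] by simp
    then show "death_tail n n r \<in> ?s ` (?S \<times> ?S)"
      using xy by (intro image_eqI[of _ _ "(?x, ?y)"]) auto
  qed
  then show ?thesis by (simp add: kingman_separation_def max_separation_def)
qed

theorem theorem7p5:
  fixes \<alpha> :: real
  assumes "0 \<le> \<alpha>" and "\<alpha> < 1"
  shows "(\<forall>n\<ge>1. \<forall>r::nat. kingman_separation 1 \<alpha> n r =
            2 * (\<Sum>i=2..n. (-1) ^ i * ((real i)\<^sup>2 - 1) * ((fact n)\<^sup>2 / (fact (n - i) * fact (n + i)))
                   * (1 - (real i)\<^sup>2 / (real n)\<^sup>2) ^ r))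
       \<and> (\<forall>c::real. c > 0 \<longrightarrow>
            (\<lambda>i::nat. (-1) ^ i * ((real i)\<^sup>2 - 1) * exp (- c * (real i)\<^sup>2)) summable_on {2..} \<and>
            (\<lambda>n. kingman_separation 1 \<alpha> n (nat \<lfloor>c * (real n)\<^sup>2\<rfloor>)) \<longlonglongrightarrow>
            2 * (\<Sum>\<^sub>\<infinity>i\<in>{2..}. (-1) ^ i * ((real i)\<^sup>2 - 1) * exp (- c * (real i)\<^sup>2)))"
proof (intro conjI allI impI)
  fix n r :: nat assume "n \<ge> 1"
  then show "kingman_separation 1 \<alpha> n r =
      2 * (\<Sum>i=2..n. (-1) ^ i * ((real i)\<^sup>2 - 1) * ((fact n)\<^sup>2 / (fact (n - i) * fact (n + i)))
        * (1 - (real i)\<^sup>2 / (real n)\<^sup>2) ^ r)"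
    using kingman_separation_eq_death_tail[OF assms] by (simp add: death_tail_def death_coeff_def)
next
  fix c :: real assume c: "c > 0"
  then show "(\<lambda>i::nat. (-1) ^ i * ((real i)\<^sup>2 - 1) * exp (- c * (real i)\<^sup>2)) summable_on {2..}"
    by (rule death_tail_diagonal_tendsto(1))
  have "\<forall>\<^sub>F n in sequentially. death_tail n n (nat \<lfloor>c * (real n)\<^sup>2\<rfloor>)
      = kingman_separation 1 \<alpha> n (nat \<lfloor>c * (real n)\<^sup>2\<rfloor>)"
    using eventually_ge_at_top[of 1]
    by eventually_elim (simp add: kingman_separation_eq_death_tail[OF assms])
  with death_tail_diagonal_tendsto(2)[OF c]
  show "(\<lambda>n. kingman_separation 1 \<alpha> n (nat \<lfloor>c * (real n)\<^sup>2\<rfloor>)) \<longlonglongrightarrow>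
      2 * (\<Sum>\<^sub>\<infinity>i\<in>{2..}. (-1) ^ i * ((real i)\<^sup>2 - 1) * exp (- c * (real i)\<^sup>2))"
    by (rule Lim_transform_eventually)
qed

end
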